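(* $\tau(\mathrm{PSG}_5)=36$ and $a(\mathrm{PSG}_5)=5!-\tau(\mathrm{PSG}_5)=84$.
   Context: Two lists $(a_1,\ldots,a_s)$ and $(b_1,\ldots,b_s)$, each with distinct entries, pattern-match if for all $i<j$ we have $a_i<a_j$ if and only if $b_i<b_j$. The pattern-shift graph $\mathrm{PSG}_r$ is the digraph (loops allowed) whose vertices are the permutations of $[r]=\{1,\ldots,r\}$ written as lists, with an edge from $a$ to $b$ (possibly $a=b$) if and only if the list of the last $r-1$ entries of $a$ and the list of the first $r-1$ entries of $b$ pattern-match. For a digraph $G$, $\tau(G)$ is the minimum size of a set of vertices which intersects every directed cycle in $G$, and $a(G)$ is the maximum size of a set of vertices inducing an acyclic subgraph, i.e. one with no directed cycle. Loops count as cycles of length 1, and directed 2-cycles count as cycles. *)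

theory Defs
  imports "HOL-Combinatorics.Multiset_Permutations" "Graph_Theory.Digraph_Component"
begin

text \<open>Only meaningful for lists with distinct entries, where comparing with \<open><\<close> determines
  the relative order.\<close>

definition pattern_match :: "'a::linorder list \<Rightarrow> 'b::linorder list \<Rightarrow> bool" where
  "pattern_match a b \<longleftrightarrow> length a = length b \<and>
     (\<forall>i j. i < j \<and> j < length a \<longrightarrow> (a ! i < a ! j \<longleftrightarrow> b ! i < b ! j))"

text \<open>Arcs are pairs of vertices, so there are no parallel arcs, and pairs \<open>(a, a)\<close>
  are allowed. On lists of length \<open>r \<ge> 1\<close>, \<open>tl\<close> and \<open>butlast\<close> give the last and
  the first \<open>r - 1\<close> entries.\<close>

definition PSG :: "nat \<Rightarrow> (nat list, nat list \<times> nat list) pre_digraph" where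
  "PSG r = \<lparr> verts = permutations_of_set {1..r},
     arcs = {(a, b). a \<in> permutations_of_set {1..r} \<and> b \<in> permutations_of_set {1..r} \<and>
                     pattern_match (tl a) (butlast b)},
     tail = fst, head = snd \<rparr>"

lemma fin_digraph_PSG: "fin_digraph (PSG r)"
proof
  have "arcs (PSG r) \<subseteq> permutations_of_set {1..r} \<times> permutations_of_set {1..r}"
    by (auto simp: PSG_def)
  then show "finite (arcs (PSG r))"
    by (rule finite_subset) simp
qed (auto simp: PSG_def)

text \<open>A cycle \<open>p\<close> in the sense of \<^const>\<open>pre_digraph.cycle\<close> is a nonempty list of arcs forming a
  closed walk without repeated vertices; loops and 2-cycles are included. As the walk is
  closed, the tails of its arcs are all of its vertices.\<close>

definition cycle_transversal :: "('a, 'b) pre_digraph \<Rightarrow> 'a set \<Rightarrow> bool" where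
  "cycle_transversal G S \<longleftrightarrow> S \<subseteq> verts G \<and>
     (\<forall>p. pre_digraph.cycle G p \<longrightarrow> S \<inter> tail G ` set p \<noteq> {})"

definition acyclic_set :: "('a, 'b) pre_digraph \<Rightarrow> 'a set \<Rightarrow> bool" where
  "acyclic_set G S \<longleftrightarrow> S \<subseteq> verts G \<and> \<not> (\<exists>p. pre_digraph.cycle (G \<restriction> S) p)"

text \<open>Both numbers are intended for finite digraphs: then the sets of cardinalities are finite,
  and they are nonempty, as witnessed by \<open>verts G\<close> and \<open>{}\<close> respectively.\<close>

definition cycle_transversal_number :: "('a, 'b) pre_digraph \<Rightarrow> nat" where
  "cycle_transversal_number G = Min (card ` {S. cycle_transversal G S})"

definition max_acyclic_number :: "('a, 'b) pre_digraph \<Rightarrow> nat" where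
  "max_acyclic_number G = Max (card ` {S. acyclic_set G S})"

end

theory Submission
  imports Defs
begin

text \<open>A vertex of \<open>PSG 5\<close> can be read as an arc, from the pattern of its first four entries to
  the pattern of its last four entries, of a multigraph on the 24 patterns of length 4. Cycles of
  \<open>PSG 5\<close> then become closed trails, and a cycle transversal becomes a feedback arc set.
  So any linear order of the 24 patterns gives a transversal, namely its backward arcs; for the order
  chosen below there are 36 of them. Conversely, \<open>PSG 5\<close> contains 36 pairwise disjoint cycles.
  Both the order and the cycles were found by computer.\<close>

section \<open>Cycle transversals and acyclic sets\<close>

context wf_digraph
begin

text \<open>Each head is the tail of the next arc, and since the walk is closed, the last head is
  the tail of the first arc. So the tails alone record all vertices of a cycle.\<close>

lemma cycle_heads_subset_tails:
  assumes "cycle p"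
  shows "head G ` set p \<subseteq> tail G ` set p"
proof -
  obtain u where u: "awalk u p u" and p: "p \<noteq> []"
    using assms by (auto simp: cycle_def)
  have "u = tail G (hd p)"
    using u p by (cases p) (auto simp: awalk_Cons_iff)
  then have "u \<in> tail G ` set p"
    using p by auto
  moreover have "head G (last p) = u"
    using u p by (auto simp: awalk_verts_conv elim!: awalkE')
  moreover have "set (awalk_verts u p) = tail G ` set p \<union> head G ` set p"
    using set_awalk_verts_not_Nil[OF u p] by simp
  ultimately show ?thesis
    using p by (auto simp: awalk_verts_conv)
qed

text \<open>The induced subgraph has the same \<open>tail\<close> and \<open>head\<close> maps, so
  walks look alike in both digraphs; heads need no separate condition, being tails
  themselves.\<close>

lemma cycle_induce_subgraph_iff:
  assumes "S \<subseteq> verts G"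
  shows "pre_digraph.cycle (G \<restriction> S) p \<longleftrightarrow> cycle p \<and> tail G ` set p \<subseteq> S"
proof -
  have cong: "pre_digraph.cas (G \<restriction> S) u p v = cas u p v"
    "pre_digraph.awalk_verts (G \<restriction> S) u p = awalk_verts u p" for u v
    using compatible_induce_subgraph[of G S]
    by (simp_all add: compatible_cas compatible_awalk_verts)
  show ?thesis
  proof
    assume "pre_digraph.cycle (G \<restriction> S) p"
    then show "cycle p \<and> tail G ` set p \<subseteq> S"
      using assms by (auto simp: pre_digraph.cycle_def pre_digraph.awalk_def cong)
  next
    assume *: "cycle p \<and> tail G ` set p \<subseteq> S"
    then have heads: "head G ` set p \<subseteq> S"
      using cycle_heads_subset_tails by blast
    from * obtain u where u: "awalk u p u" "distinct (tl (awalk_verts u p))" "p \<noteq> []"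
      by (auto simp: cycle_def)
    have "u \<in> S"
      using u * by (cases p) (auto simp: awalk_Cons_iff)
    then show "pre_digraph.cycle (G \<restriction> S) p"
      using u * heads by (auto simp: pre_digraph.cycle_def pre_digraph.awalk_def cong)
  qed
qed

text \<open>A cycle lies inside \<open>S\<close> exactly when it misses the complement of
  \<open>S\<close>.\<close>

lemma acyclic_set_iff:
  "acyclic_set G S \<longleftrightarrow> S \<subseteq> verts G \<and> cycle_transversal G (verts G - S)"
proof -
  have "tail G ` set p \<subseteq> verts G" if "cycle p" for p
    using that by (auto simp: cycle_def awalk_def)
  then have "tail G ` set p \<subseteq> S \<longleftrightarrow> (verts G - S) \<inter> tail G ` set p = {}" if "cycle p" for p
    using that by fast
  then show ?thesis
    by (auto simp: acyclic_set_def cycle_transversal_def cycle_induce_subgraph_iff)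
qed

text \<open>On a cycle avoiding \<open>S\<close>, the arc whose tail maximizes \<open>f\<close>
  would have a head of larger value, yet that head is again a tail of the cycle.\<close>

lemma cycle_transversal_potential:
  fixes f :: "'a \<Rightarrow> 'c::linorder"
  assumes "S \<subseteq> verts G"
    and "\<And>e. e \<in> arcs G \<Longrightarrow> tail G e \<notin> S \<Longrightarrow> f (tail G e) < f (head G e)"
  shows "cycle_transversal G S"
  unfolding cycle_transversal_def
proof (intro conjI allI impI notI)
  fix p assume p: "cycle p" and disjoint: "S \<inter> tail G ` set p = {}"
  let ?M = "Max (f ` tail G ` set p)"
  have "p \<noteq> []"
    using p by (auto simp: cycle_def)
  then have "?M \<in> f ` tail G ` set p"
    by (intro Max_in) auto
  then obtain e where e: "e \<in> set p" "?M = f (tail G e)"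
    by auto
  have "e \<in> arcs G"
    using p e by (auto simp: cycle_def awalk_def)
  moreover have "tail G e \<notin> S"
    using e disjoint by auto
  ultimately have "?M < f (head G e)"
    using assms e by simp
  moreover have "f (head G e) \<le> ?M"
    using cycle_heads_subset_tails[OF p] e by (intro Max_ge) auto
  ultimately show False
    by simp
qed (fact assms(1))

end

text \<open>Zipping with the rotated list pairs every vertex with its cyclic successor; a singleton
  list yields a loop.\<close>

lemma cycle_zip_rotate1:
  fixes G :: "('a, 'a \<times> 'a) pre_digraph"
  assumes G: "wf_digraph G" "tail G = fst" "head G = snd"
    and arcs: "set (zip vs (rotate1 vs)) \<subseteq> arcs G"
    and vs: "vs \<noteq> []" "distinct vs"
  shows "pre_digraph.cycle G (zip vs (rotate1 vs))"
proof -
  interpret wf_digraph G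
    by fact
  obtain v ws where v: "vs = v # ws"
    using vs by (cases vs) auto
  \<comment> \<open>The endpoint \<open>w\<close> is kept apart from the start \<open>u\<close> so
    that the induction goes through; the closed walk is the case where both are
    \<open>v\<close>.\<close>
  have cas: "cas u (zip (u # xs) (xs @ [w])) w" for u w xs
    by (induction xs arbitrary: u) (auto simp: G)
  obtain w es where e: "zip vs (rotate1 vs) = (v, w) # es"
    by (cases ws) (auto simp: v)
  have "v \<in> verts G"
    using e arcs tail_in_verts[of "(v, w)"] by (auto simp: G)
  then have walk: "awalk v (zip vs (rotate1 vs)) v"
    using arcs cas[of v ws v] by (simp add: awalk_def v)
  have "awalk_verts v (zip vs (rotate1 vs)) = v # rotate1 vs"
    using walk by (subst awalk_verts_conv'[of v _ v]) (simp_all add: awalk_def G v hd_zip)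
  then show ?thesis
    using walk e vs by (auto simp: cycle_def)
qed

lemma (in fin_digraph) max_acyclic_number_eq:
  "max_acyclic_number G = card (verts G) - cycle_transversal_number G"
proof -
  let ?T = "{T. cycle_transversal G T}"
  have fin: "finite ?T"
    by (rule finite_subset[of _ "Pow (verts G)"]) (auto simp: cycle_transversal_def)
  \<comment> \<open>The empty set is acyclic, as a walk needs a start vertex; hence some transversal
    exists and the minimum is attained.\<close>
  have "verts G \<in> ?T"
    using acyclic_set_iff[of "{}"]
    by (auto simp: acyclic_set_def pre_digraph.cycle_def pre_digraph.awalk_def)
  then have "cycle_transversal_number G \<in> card ` ?T"
    unfolding cycle_transversal_number_def using fin by (intro Min_in) auto
  then obtain T where T: "cycle_transversal G T" "card T = cycle_transversal_number G"
    by auto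
  have T_sub: "T \<subseteq> verts G"
    using T by (simp add: cycle_transversal_def)
  show ?thesis
    unfolding max_acyclic_number_def
  proof (rule Max_eqI)
    show "finite (card ` {S. acyclic_set G S})"
      by (rule finite_imageI, rule finite_subset[of _ "Pow (verts G)"]) (auto simp: acyclic_set_def)
    have "acyclic_set G (verts G - T)"
      using T T_sub by (simp add: acyclic_set_iff double_diff)
    moreover have "card (verts G - T) = card (verts G) - cycle_transversal_number G"
      using T T_sub by (simp add: card_Diff_subset finite_subset)
    ultimately show "card (verts G) - cycle_transversal_number G \<in> card ` {S. acyclic_set G S}"
      by (metis imageI mem_Collect_eq)
  next
    fix n assume "n \<in> card ` {S. acyclic_set G S}"
    then obtain S where S: "n = card S" "S \<subseteq> verts G" "cycle_transversal G (verts G - S)"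
      by (auto simp: acyclic_set_iff)
    have "cycle_transversal_number G \<le> card (verts G - S)"
      unfolding cycle_transversal_number_def using fin S by (intro Min_le) auto
    \<comment> \<open>Subtraction on \<open>nat\<close> truncates, so
      \<open>card S \<le> card (verts G)\<close> is supplied to rearrange the inequality.\<close>
    then show "n \<le> card (verts G) - cycle_transversal_number G"
      using S card_mono[OF finite_verts S(2)]
      by (simp add: card_Diff_subset finite_subset)
  qed
qed

text \<open>Disjoint lists are hit by different elements of \<open>S\<close>: the element
  \<open>x\<close> hitting the first list is removed, and the rest of \<open>S\<close> still hits
  the remaining lists.\<close>

lemma length_le_card_if_hitting:
  assumes "finite S" "distinct (concat xss)" "\<And>xs. xs \<in> set xss \<Longrightarrow> S \<inter> set xs \<noteq> {}"
  shows "length xss \<le> card S"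
  using assms
proof (induction xss arbitrary: S)
  case (Cons xs xss)
  obtain x where x: "x \<in> S" "x \<in> set xs"
    using Cons.prems(3)[of xs] by auto
  have "length xss \<le> card (S - {x})"
  proof (rule Cons.IH)
    fix ys assume "ys \<in> set xss"
    moreover from this have "x \<notin> set ys"
      using Cons.prems(2) x by auto
    ultimately show "(S - {x}) \<inter> set ys \<noteq> {}"
      using Cons.prems(3)[of ys] by auto
  qed (use Cons.prems in auto)
  then show ?case
    using x Cons.prems(1) by (metis Suc_le_mono card_Suc_Diff1 length_Cons)
qed simp

section \<open>Evaluating pattern matching\<close>

lemma pattern_match_sym: "pattern_match a b \<Longrightarrow> pattern_match b a"
  by (simp add: pattern_match_def)

lemma pattern_match_trans: "pattern_match a b \<Longrightarrow> pattern_match b c \<Longrightarrow> pattern_match a c"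
  by (simp add: pattern_match_def)

lemma pattern_match_Cons:
  "pattern_match (x # xs) (y # ys) \<longleftrightarrow>
     list_all2 (\<lambda>u v. x < u \<longleftrightarrow> y < v) xs ys \<and> pattern_match xs ys"
  (is "?l \<longleftrightarrow> ?r")
proof
  assume l: ?l
  then have cmp: "(x # xs) ! i < (x # xs) ! j \<longleftrightarrow> (y # ys) ! i < (y # ys) ! j"
    if "i < j" "j < length (x # xs)" for i j
    using that by (simp add: pattern_match_def)
  show ?r
    using l cmp[of 0 "Suc j" for j] cmp[of "Suc i" "Suc j" for i j]
    by (simp add: pattern_match_def list_all2_conv_all_nth)
next
  assume ?r
  then show ?l
    by (simp add: pattern_match_def list_all2_conv_all_nth nth_Cons split: nat.split)
qed

text \<open>Structural recursion replaces the quantifiers over all indices in the definition, so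
  that \<open>code_simp\<close> can decide concrete instances.\<close>

lemma pattern_match_code [code]:
  "pattern_match [] [] \<longleftrightarrow> True"
  "pattern_match [] (y # ys) \<longleftrightarrow> False"
  "pattern_match (x # xs) [] \<longleftrightarrow> False"
  "pattern_match (x # xs) (y # ys) \<longleftrightarrow>
     list_all2 (\<lambda>u v. x < u \<longleftrightarrow> y < v) xs ys \<and> pattern_match xs ys"
  by (simp_all only: pattern_match_Cons) (simp_all add: pattern_match_def)

text \<open>On patterns absent from \<open>ps\<close> this is \<open>length ps\<close>.\<close>

definition pattern_index :: "nat list list \<Rightarrow> nat list \<Rightarrow> nat" where
  "pattern_index ps a = length (takeWhile (\<lambda>q. \<not> pattern_match q a) ps)"

text \<open>Along an arc from \<open>a\<close> to \<open>b\<close>, the lists \<open>tl a\<close>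
  and \<open>butlast b\<close> agree only as patterns; this identifies their positions in the
  order.\<close>

lemma pattern_index_cong:
  assumes "pattern_match a b"
  shows "pattern_index ps a = pattern_index ps b"
proof -
  have "pattern_match q a \<longleftrightarrow> pattern_match q b" for q :: "nat list"
    using assms pattern_match_sym pattern_match_trans by blast
  then show ?thesis
    by (simp add: pattern_index_def)
qed

definition perms5 :: "nat list list" where
  "perms5 = permutations_of_set_list [1, 2, 3, 4, 5]"

lemma verts_PSG_5: "verts (PSG 5) = set perms5"
proof -
  have "{1..5::nat} = set [1, 2, 3, 4, 5]"
    by auto
  then show ?thesis
    by (simp only: PSG_def pre_digraph.simps permutations_of_list_code perms5_def) simp
qed

lemma distinct_perms5: "distinct perms5"
  by (simp add: perms5_def distinct_permutations_of_set_list)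

section \<open>The order and the cycles\<close>

definition pattern_order :: "nat list list" where
  "pattern_order =
    [[4,2,3,1], [3,2,4,1], [2,3,4,1], [1,3,4,2], [3,4,1,2], [2,4,1,3],
     [4,1,3,2], [3,4,2,1], [2,3,1,4], [3,1,4,2], [2,1,4,3], [1,2,4,3],
     [2,4,3,1], [1,4,3,2], [4,3,2,1], [4,3,1,2], [4,2,1,3], [1,4,2,3],
     [4,1,2,3], [3,2,1,4], [3,1,2,4], [1,3,2,4], [2,1,3,4], [1,2,3,4]]"

text \<open>The weak inequality makes loops backward: the two monotone permutations have equal
  initial and final patterns.\<close>

definition backward :: "nat list \<Rightarrow> bool" where
  "backward a \<longleftrightarrow> pattern_index pattern_order (tl a) \<le> pattern_index pattern_order (butlast a)"

lemma card_backward: "length (filter backward perms5) = 36"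
  by code_simp

text \<open>The potential is the position of the initial pattern: for an arc from a non-backward
  \<open>a\<close> to \<open>b\<close>, the pattern of \<open>butlast b\<close> is that of
  \<open>tl a\<close>, which comes later than that of \<open>butlast a\<close>.\<close>

lemma cycle_transversal_backward: "cycle_transversal (PSG 5) (set (filter backward perms5))"
proof -
  interpret fin_digraph "PSG 5"
    by (rule fin_digraph_PSG)
  show ?thesis
  proof (rule cycle_transversal_potential[where f = "\<lambda>a. pattern_index pattern_order (butlast a)"])
    show "set (filter backward perms5) \<subseteq> verts (PSG 5)"
      by (auto simp: verts_PSG_5)
  next
    fix e
    assume e: "e \<in> arcs (PSG 5)" "tail (PSG 5) e \<notin> set (filter backward perms5)"
    have "\<not> backward (tail (PSG 5) e)"
      using e tail_in_verts by (auto simp: verts_PSG_5)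
    moreover have "pattern_match (tl (tail (PSG 5) e)) (butlast (head (PSG 5) e))"
      using e by (auto simp: PSG_def)
    ultimately show "pattern_index pattern_order (butlast (tail (PSG 5) e))
        < pattern_index pattern_order (butlast (head (PSG 5) e))"
      by (simp add: backward_def pattern_index_cong)
  qed
qed

text \<open>Each list is read cyclically. There are 2, 6, 10, 14 and 4 cycles of lengths 1 to 5,
  with 120 vertices in all, so they partition the vertex set.\<close>

definition disjoint_cycles :: "nat list list list" where
  "disjoint_cycles =
    [[[1,2,3,4,5]],
     [[5,4,3,2,1]],
     [[1,3,2,5,4], [2,1,4,3,5]],
     [[1,4,2,5,3], [3,1,4,2,5]],
     [[1,5,2,4,3], [5,1,4,2,3]],
     [[3,4,2,5,1], [3,2,4,1,5]],
     [[3,5,2,4,1], [5,2,4,1,3]],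
     [[4,5,2,3,1], [5,3,4,1,2]],
     [[1,2,4,3,5], [1,3,2,4,5], [2,1,3,5,4]],
     [[1,2,5,3,4], [1,5,2,3,4], [5,1,2,4,3]],
     [[1,3,4,2,5], [2,3,1,4,5], [3,1,4,5,2]],
     [[1,3,5,2,4], [2,4,1,3,5], [4,1,3,5,2]],
     [[1,4,3,2,5], [4,2,1,5,3], [3,1,5,4,2]],
     [[1,4,5,2,3], [4,5,1,2,3], [5,1,3,4,2]],
     [[1,5,4,2,3], [5,4,1,3,2], [5,1,4,3,2]],
     [[2,4,5,1,3], [3,5,1,2,4], [5,2,3,4,1]],
     [[2,5,3,1,4], [5,3,1,4,2], [4,2,5,3,1]],
     [[4,3,5,2,1], [4,5,2,1,3], [5,3,2,4,1]],
     [[1,3,4,5,2], [2,3,5,1,4], [2,5,1,3,4], [4,1,2,3,5]],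
     [[1,3,5,4,2], [2,5,4,1,3], [4,3,1,2,5], [3,1,2,5,4]],
     [[1,4,3,5,2], [3,2,5,1,4], [2,5,1,4,3], [4,1,3,2,5]],
     [[1,4,5,3,2], [3,4,2,1,5], [3,2,1,4,5], [2,1,4,5,3]],
     [[1,5,3,4,2], [4,2,3,1,5], [2,3,1,5,4], [2,1,5,3,4]],
     [[1,5,4,3,2], [5,4,2,1,3], [5,2,1,4,3], [2,1,5,4,3]],
     [[2,3,4,5,1], [3,4,5,1,2], [3,4,1,2,5], [3,1,2,4,5]],
     [[2,3,5,4,1], [3,5,4,1,2], [5,3,1,2,4], [4,1,2,5,3]],
     [[2,4,3,5,1], [4,2,5,1,3], [3,5,1,4,2], [5,1,3,2,4]],
     [[2,5,3,4,1], [5,2,3,1,4], [3,4,1,5,2], [4,1,5,2,3]],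
     [[2,5,4,3,1], [5,3,2,1,4], [4,3,1,5,2], [4,1,5,3,2]],
     [[3,2,4,5,1], [3,4,5,2,1], [3,5,2,1,4], [5,2,1,3,4]],
     [[3,2,5,4,1], [3,5,4,2,1], [4,3,2,1,5], [3,2,1,5,4]],
     [[4,5,3,2,1], [5,4,3,1,2], [5,4,2,3,1], [5,3,4,2,1]],
     [[1,2,3,5,4], [1,2,5,4,3], [1,5,3,2,4], [4,2,1,3,5], [2,1,3,4,5]],
     [[1,2,4,5,3], [2,4,5,3,1], [4,5,3,1,2], [5,4,1,2,3], [5,1,2,3,4]],
     [[1,4,2,3,5], [4,2,3,5,1], [2,3,4,1,5], [2,4,1,5,3], [3,1,5,2,4]],
     [[2,4,3,1,5], [4,3,2,5,1], [4,3,5,1,2], [4,5,1,3,2], [5,2,4,3,1]]]"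

lemma distinct_disjoint_cycles: "distinct (concat disjoint_cycles)"
  by code_simp

text \<open>These are the hypotheses of \<open>cycle_zip_rotate1\<close>, stated over explicit lists
  so that they can be evaluated.\<close>

lemma disjoint_cycles_arcs:
  "\<forall>vs \<in> set disjoint_cycles. vs \<noteq> [] \<and> distinct vs \<and>
     (\<forall>(a, b) \<in> set (zip vs (rotate1 vs)). a \<in> set perms5 \<and> b \<in> set perms5 \<and>
        pattern_match (tl a) (butlast b))"
  by code_simp

lemma card_cycle_transversal_ge:
  assumes "cycle_transversal (PSG 5) S"
  shows "36 \<le> card S"
proof -
  interpret fin_digraph "PSG 5"
    by (rule fin_digraph_PSG)
  have "length disjoint_cycles \<le> card S"
  proof (rule length_le_card_if_hitting[OF _ distinct_disjoint_cycles])
    show "finite S"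
      using assms by (auto simp: cycle_transversal_def intro: finite_subset)
  next
    fix vs assume vs: "vs \<in> set disjoint_cycles"
    have PSG: "tail (PSG 5) = fst" "head (PSG 5) = snd"
      by (simp_all add: PSG_def)
    have "set (zip vs (rotate1 vs)) \<subseteq> arcs (PSG 5)"
      using disjoint_cycles_arcs vs verts_PSG_5 by (fastforce simp: PSG_def)
    then have "cycle (zip vs (rotate1 vs))"
      using disjoint_cycles_arcs vs by (intro cycle_zip_rotate1 wf_digraph_axioms PSG) auto
    \<comment> \<open>The tails of the zipped arcs are first components, hence members of
      \<open>vs\<close>.\<close>
    then show "S \<inter> set vs \<noteq> {}"
      using assms by (fastforce simp: cycle_transversal_def PSG dest: set_zip_leftD)
  qed
  then show ?thesis
    by (simp add: disjoint_cycles_def)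
qed

lemma cycle_transversal_number_PSG_5: "cycle_transversal_number (PSG 5) = 36"
  unfolding cycle_transversal_number_def
proof (rule Min_eqI)
  show "finite (card ` {S. cycle_transversal (PSG 5) S})"
    by (rule finite_imageI, rule finite_subset[of _ "Pow (verts (PSG 5))"])
      (auto simp: cycle_transversal_def verts_PSG_5)
next
  have "card (set (filter backward perms5)) = 36"
    using card_backward distinct_perms5 by (metis distinct_card distinct_filter)
  then show "36 \<in> card ` {S. cycle_transversal (PSG 5) S}"
    using cycle_transversal_backward by (metis imageI mem_Collect_eq)
qed (auto intro: card_cycle_transversal_ge)

theorem proposition30:
  shows "cycle_transversal_number (PSG 5) = 36 \<and>
         max_acyclic_number (PSG 5) = fact 5 - cycle_transversal_number (PSG 5) \<and>
         fact 5 - cycle_transversal_number (PSG 5) = 84"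
proof -
  have "card (verts (PSG 5)) = fact 5"
    by (simp add: PSG_def)
  then have "max_acyclic_number (PSG 5) = fact 5 - cycle_transversal_number (PSG 5)"
    by (simp add: fin_digraph.max_acyclic_number_eq[OF fin_digraph_PSG])
  then show ?thesis
    by (simp add: cycle_transversal_number_PSG_5 fact_numeral)
qed

end
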